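(* Let $n \geq 4$. Let $X$ be the half cube $h\gamma_n$ regarded as a subspace of $\mathbb{R}^n$, and let $E$ be the union of the following three sets: (a) the set of vertices of $h\gamma_n$; (b) the set of interiors of all $k$-faces of $h\gamma_n$ for all $0 < k < n$; (c) the interior of $h\gamma_n$ itself (as a single element). Then $(X,E,\Phi)$ is a regular CW complex, where the maps $\Phi_e$ ($e \in E$) are the natural identifications.
   Context: Let $\Psi^+_n$ be the set of points of $\{\pm1\}^n \subset \mathbb{R}^n$ with an even number of negative coordinates. The half cube $h\gamma_n$ is the convex hull of $\Psi^+_n$; its $k$-faces are its $k$-dimensional faces as a convex polytope. The interior of a face means its relative interior. A $k$-cell is a homeomorphic copy of the open $k$-disk $D^k - S^{k-1}$. A map $g:(X,A)\to(Y,B)$ is a relative homeomorphism if it is continuous, $g(A)\subseteq B$, and $g|_{X-A}: X-A \to Y-B$ is a homeomorphism. A (finite) CW complex is an ordered triple $(X,E,\Phi)$ where $X$ is a Hausdorff space, $E$ is a (finite) family of cells in $X$, and $\Phi = \{\Phi_e : e\in E\}$ is a family of maps such that (i) $X = \bigcup\{e : e\in E\}$ is a disjoint union; (ii) for each $k$-cell $e\in E$, the map $\Phi_e : (D^k,S^{k-1}) \to (e\cup X^{(k-1)}, X^{(k-1)})$ is a relative homeomorphism, where $X^{(k)} = \bigcup\{e\in E : \dim e\le k\}$. (In (ii), as usual, $\Phi_e$ is required to restrict to a homeomorphism of $D^k - S^{k-1}$ onto $e$.) The complex is regular if every $\Phi_e$, regarded as a map onto its image, is a homeomorphism. The natural identification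 $\Phi_e$, for $e$ the interior of a $k$-face $F$, is a homeomorphism of the closed disk $D^k$ onto the closed face $F=\overline{e}$ carrying $S^{k-1}$ onto the relative boundary of $F$. *)

theory Defs
  imports "HOL-Analysis.Analysis"
begin

section \<open>Disks and cells\<close>

text \<open>The disks of all dimensions live in one type: \<^term>\<open>Euclidean_space k\<close> consists of the
  functions on the naturals that vanish from \<open>k\<close> on. The sphere is a set rather than the library's
  \<^const>\<open>nsphere\<close>, because \<open>S\<^sup>k\<^sup>-\<^sup>1\<close> has to be empty for \<open>k = 0\<close>.\<close>

definition closed_disk :: "nat \<Rightarrow> (nat \<Rightarrow> real) topology" where
  "closed_disk k = subtopology (Euclidean_space k) {x. (\<Sum>i<k. (x i)\<^sup>2) \<le> 1}"

definition disk_boundary :: "nat \<Rightarrow> (nat \<Rightarrow> real) set" where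
  "disk_boundary k = {x \<in> topspace (Euclidean_space k). (\<Sum>i<k. (x i)\<^sup>2) = 1}"

definition open_disk :: "nat \<Rightarrow> (nat \<Rightarrow> real) topology" where
  "open_disk k = subtopology (closed_disk k) (topspace (closed_disk k) - disk_boundary k)"

lemma disk_boundary_0: "disk_boundary 0 = {}"
  by (simp add: disk_boundary_def)

lemma disk_boundary_Suc: "disk_boundary (Suc p) = topspace (nsphere p)"
  by (auto simp: disk_boundary_def nsphere topspace_Euclidean_space Suc_le_eq lessThan_Suc_atMost)

definition is_cell :: "'a topology \<Rightarrow> nat \<Rightarrow> 'a set \<Rightarrow> bool" where
  "is_cell X k e \<longleftrightarrow> e \<subseteq> topspace X \<and> subtopology X e homeomorphic_space open_disk k"


section \<open>Finite CW complexes\<close>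

definition relative_homeomorphism ::
    "'a topology \<Rightarrow> 'a set \<Rightarrow> 'b topology \<Rightarrow> 'b set \<Rightarrow> ('a \<Rightarrow> 'b) \<Rightarrow> bool" where
  "relative_homeomorphism X A Y B g \<longleftrightarrow>
     A \<subseteq> topspace X \<and> B \<subseteq> topspace Y \<and>
     continuous_map X Y g \<and> g ` A \<subseteq> B \<and>
     homeomorphic_map (subtopology X (topspace X - A)) (subtopology Y (topspace Y - B)) g"

text \<open>The index is an integer so that the skeleton of index \<open>-1\<close> is empty.\<close>

definition skeleton :: "'a topology \<Rightarrow> 'a set set \<Rightarrow> int \<Rightarrow> 'a set" where
  "skeleton X E k = \<Union>{e \<in> E. \<exists>j. is_cell X j e \<and> int j \<le> k}"

text \<open>The last conjunct makes explicit that the open disk is carried homeomorphically onto the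
  cell itself.\<close>

definition CW_complex ::
    "'a topology \<Rightarrow> 'a set set \<Rightarrow> ('a set \<Rightarrow> (nat \<Rightarrow> real) \<Rightarrow> 'a) \<Rightarrow> bool" where
  "CW_complex X E \<Phi> \<longleftrightarrow>
     Hausdorff_space X \<and>
     finite E \<and> (\<forall>e\<in>E. \<exists>k. is_cell X k e) \<and>
     \<Union>E = topspace X \<and> pairwise disjnt E \<and>
     (\<forall>e\<in>E. \<forall>k. is_cell X k e \<longrightarrow>
        relative_homeomorphism
          (closed_disk k) (disk_boundary k)
          (subtopology X (e \<union> skeleton X E (int k - 1))) (skeleton X E (int k - 1)) (\<Phi> e) \<and>
        homeomorphic_map (open_disk k) (subtopology X e) (\<Phi> e))"

definition regular_CW_complex ::
    "'a topology \<Rightarrow> 'a set set \<Rightarrow> ('a set \<Rightarrow> (nat \<Rightarrow> real) \<Rightarrow> 'a) \<Rightarrow> bool" where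
  "regular_CW_complex X E \<Phi> \<longleftrightarrow>
     CW_complex X E \<Phi> \<and>
     (\<forall>e\<in>E. \<forall>k. is_cell X k e \<longrightarrow> embedding_map (closed_disk k) X (\<Phi> e))"


section \<open>The half cube\<close>

definition half_cube_points :: "(real ^ 'n) set" where
  "half_cube_points = {x. (\<forall>i. x $ i = 1 \<or> x $ i = - 1) \<and> even (card {i. x $ i < 0})}"

definition half_cube :: "(real ^ 'n) set" where
  "half_cube = convex hull half_cube_points"

definition is_k_face :: "'a::euclidean_space set \<Rightarrow> nat \<Rightarrow> 'a set \<Rightarrow> bool" where
  "is_k_face P k F \<longleftrightarrow> F face_of P \<and> aff_dim F = int k"

definition half_cube_cells :: "(real ^ 'n) set set" where
  "half_cube_cells =
     {{v} |v. v extreme_point_of half_cube} \<union>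
     {rel_interior F |F k. 0 < k \<and> k < CARD('n) \<and> is_k_face half_cube k F} \<union>
     {rel_interior half_cube}"

text \<open>Natural identifications of closed disks with the closed faces of a polytope are determined
  only up to the choice of a homeomorphism of pairs, so they are described by a predicate. The face
  \<open>F\<close> is determined by its relative interior \<open>e\<close>, and \<open>P\<close> itself counts as a face.\<close>

definition natural_identifications ::
    "'a::euclidean_space set \<Rightarrow> 'a set set \<Rightarrow> ('a set \<Rightarrow> (nat \<Rightarrow> real) \<Rightarrow> 'a) \<Rightarrow> bool" where
  "natural_identifications P E \<Phi> \<longleftrightarrow>
     (\<forall>e\<in>E. \<forall>k F. is_k_face P k F \<and> e = rel_interior F \<longrightarrow>
        homeomorphic_map (closed_disk k) (top_of_set F) (\<Phi> e) \<and>
        \<Phi> e ` disk_boundary k = rel_frontier F)"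

end

theory Submission
  imports Defs "HOL-Homology.Invariance_of_Domain"
begin

text \<open>
  The statement holds for every polytope \<open>P\<close>, with the relative interiors of the nonempty faces as
  cells. The half cube is a polytope, as the convex hull of a finite set, and \<open>half_cube_cells_eq\<close>
  identifies its three families of cells with those relative interiors.

  Two facts of convex geometry give the decomposition. Descending through proper faces, every point
  of \<open>P\<close> lies in the relative interior of some face (\<open>ex_face_interior\<close>), and a face is determined by
  any point of its relative interior. So the cells partition \<open>P\<close>, and the relative frontier of a face
  is covered by cells of smaller dimension (\<open>rel_frontier_subset_skeleton\<close>).

  Two facts of topology give the cell structure. A compact convex set of dimension \<open>k\<close> is
  homeomorphic to a ball in a \<open>k\<close>-dimensional subspace, and by invariance of domain such a
  homeomorphism respects relative interiors; hence natural identifications exist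
  (\<open>ex_disk_homeomorphism\<close>). Open disks of different dimensions are not homeomorphic
  (\<open>open_disk_dimension_le\<close>), so the dimension of a cell is the dimension of its face and the
  skeleton of index \<open>i\<close> is the union of the cells of the faces of dimension at most \<open>i\<close>. A natural
  identification of a face is then an embedding of the closed disk that sends the boundary into the
  lower skeleton and the open disk onto the cell.
\<close>

section \<open>Faces as closed disks\<close>

text \<open>Invariance of domain inside the affine hulls: a relatively open set in the affine hull of \<open>S\<close>
  has a relatively open image because the two hulls have the same dimension.\<close>

lemma homeomorphism_image_rel_interior:
  fixes S :: "'a::euclidean_space set" and T :: "'b::euclidean_space set"
  assumes hom: "homeomorphism S T f g" and dim: "aff_dim S = aff_dim T"
  shows "f ` rel_interior S = rel_interior T"
proof
  have inj: "inj_on f S" "inj_on g T"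
    using hom by (auto simp: homeomorphism_def intro: inj_on_inverseI)
  have "f ` rel_interior S \<subseteq> rel_interior (f ` S)"
    by (rule continuous_image_subset_rel_interior[where T = T]) (use hom dim inj in \<open>auto simp: homeomorphism_def\<close>)
  then show "f ` rel_interior S \<subseteq> rel_interior T"
    using hom by (auto simp: homeomorphism_def)
  have "g ` rel_interior T \<subseteq> rel_interior (g ` T)"
    by (rule continuous_image_subset_rel_interior[where T = S]) (use hom dim inj in \<open>auto simp: homeomorphism_def\<close>)
  then have g: "g y \<in> rel_interior S" if "y \<in> rel_interior T" for y
    using hom that by (auto simp: homeomorphism_def)
  show "rel_interior T \<subseteq> f ` rel_interior S"
  proof
    fix y assume y: "y \<in> rel_interior T"
    then have "f (g y) = y"
      using hom rel_interior_subset by (fastforce simp: homeomorphism_def)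
    with g[OF y] show "y \<in> f ` rel_interior S"
      by force
  qed
qed

text \<open>Disks are sets of sequences, whereas the results on convex sets concern Euclidean spaces. An
  orthonormal family of \<open>k\<close> vectors transports the one into the other isometrically.\<close>

lemma closed_disk_as_unit_ball:
  assumes "k \<le> DIM('a::euclidean_space)"
  obtains V :: "'a::euclidean_space set" and f where
    "subspace V" "dim V = k"
    "homeomorphic_map (closed_disk k) (top_of_set (V \<inter> cball 0 1)) f"
    "f ` disk_boundary k = V \<inter> sphere 0 1"
proof -
  obtain B :: "'a set" where B: "B \<subseteq> Basis" "card B = k"
    using obtain_subset_with_card_n[OF assms] by metis
  have indep: "independent B" and orth: "pairwise orthogonal B"
    using B(1) independent_mono[OF independent_Basis] pairwise_subset[OF orthogonal_Basis] by blast+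
  have "norm u = 1" if "u \<in> B" for u
    using that B(1) by auto
  then obtain f g where fg: "homeomorphic_maps (Euclidean_space k) (top_of_set (span B)) f g"
    and norm: "\<And>x. x \<in> topspace (Euclidean_space k) \<Longrightarrow> (norm (f x))\<^sup>2 = (\<Sum>i<k. (x i)\<^sup>2)"
    using homeomorphic_maps_Euclidean_space_euclidean_gen[OF indep orth B(2)] by metis
  have map: "homeomorphic_map (Euclidean_space k) (top_of_set (span B)) f"
    using fg homeomorphic_maps_map by blast
  then have surj: "f ` topspace (Euclidean_space k) = span B"
    by (simp add: homeomorphic_eq_everything_map)
  have "norm (f x) \<le> 1 \<longleftrightarrow> (\<Sum>i<k. (x i)\<^sup>2) \<le> 1" "norm (f x) = 1 \<longleftrightarrow> (\<Sum>i<k. (x i)\<^sup>2) = 1"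
    if "x \<in> topspace (Euclidean_space k)" for x
    using norm[OF that] abs_square_le_1[of "norm (f x)"] abs_square_eq_1[of "norm (f x)"] by simp_all
  note norm1 = this
  show thesis
  proof
    show "homeomorphic_map (closed_disk k) (top_of_set (span B \<inter> cball 0 1)) f"
      unfolding closed_disk_def subtopology_subtopology[symmetric]
      by (rule homeomorphic_map_subtopologies_alt[OF map]) (simp add: norm1)
    have "disk_boundary k = {x \<in> topspace (Euclidean_space k). norm (f x) = 1}"
      by (auto simp: disk_boundary_def norm1)
    then show "f ` disk_boundary k = span B \<inter> sphere 0 1"
      using surj[symmetric] by auto
    show "dim (span B) = k"
      using dim_span_eq_card_independent[OF indep] B(2) by simp
  qed simp
qed

lemma ex_disk_homeomorphism:
  fixes F :: "'a::euclidean_space set"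
  assumes "convex F" "compact F" and dim: "aff_dim F = int k"
  obtains h where "homeomorphic_map (closed_disk k) (top_of_set F) h"
    "h ` disk_boundary k = rel_frontier F"
proof -
  have "k \<le> DIM('a)"
    using aff_dim_le_DIM[of F] dim by simp
  then obtain V :: "'a set" and f where V: "subspace V" "dim V = k"
    and f: "homeomorphic_map (closed_disk k) (top_of_set (V \<inter> cball 0 1)) f"
    and bd: "f ` disk_boundary k = V \<inter> sphere 0 1"
    by (rule closed_disk_as_unit_ball)
  let ?D = "cball 0 1 \<inter> V"
  have "0 \<in> interior (cball (0::'a) 1) \<inter> V"
    using subspace_0[OF V(1)] by simp
  then have ne: "interior (cball (0::'a) 1) \<inter> V \<noteq> {}"
    by blast
  have frontier: "rel_frontier ?D = V \<inter> sphere 0 1"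
    using convex_affine_rel_frontier_Int[OF convex_cball subspace_imp_affine[OF V(1)] ne] by auto
  have "aff_dim (V \<inter> cball 0 1) = aff_dim V"
    using ne by (intro aff_dim_convex_Int_nonempty_interior subspace_imp_convex V(1)) auto
  then have dimD: "aff_dim ?D = aff_dim F"
    using V dim by (simp add: aff_dim_subspace Int_commute)
  have "compact ?D" "convex ?D"
    using V(1) by (auto simp: closed_subspace compact_Int_closed convex_Int subspace_imp_convex)
  then have "?D homeomorphic F"
    using assms dimD by (intro homeomorphic_convex_compact_sets) auto
  then obtain u v where uv: "homeomorphism ?D F u v"
    by (auto simp: homeomorphic_def)
  have u: "homeomorphic_map (top_of_set (V \<inter> cball 0 1)) (top_of_set F) u"
    using uv by (auto simp: homeomorphic_map_maps Int_commute)
  have "u ` rel_frontier ?D = u ` (?D - rel_interior ?D)"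
    using \<open>compact ?D\<close> by (simp add: rel_frontier_def compact_imp_closed)
  also have "\<dots> = u ` ?D - u ` rel_interior ?D"
    using uv by (intro inj_on_image_set_diff[where C = ?D] rel_interior_subset Diff_subset)
      (auto simp: homeomorphism_def intro: inj_on_inverseI)
  also have "\<dots> = rel_frontier F"
    using homeomorphism_image_rel_interior[OF uv dimD] uv assms
    by (simp add: rel_frontier_def compact_imp_closed homeomorphism_def)
  finally have "u ` (V \<inter> sphere 0 1) = rel_frontier F"
    by (simp add: frontier)
  then have "(u \<circ> f) ` disk_boundary k = rel_frontier F"
    by (metis image_comp bd)
  with homeomorphic_map_compose[OF f u] show thesis
    by (rule that)
qed

section \<open>The dimension of a cell\<close>

lemma openin_open_disk: "openin (Euclidean_space k) (topspace (open_disk k))"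
  and open_disk_eq: "open_disk k = subtopology (Euclidean_space k) (topspace (open_disk k))"
  and zero_in_open_disk: "(\<lambda>i. 0) \<in> topspace (open_disk k)"
proof -
  have top: "topspace (open_disk k) = {x \<in> topspace (Euclidean_space k). (\<Sum>i<k. (x i)\<^sup>2) \<in> {..<1}}"
    by (auto simp: open_disk_def closed_disk_def disk_boundary_def)
  have "continuous_map (Euclidean_space k) euclideanreal (\<lambda>x. x i)" for i
    unfolding Euclidean_space_def by (intro continuous_map_from_subtopology continuous_map_product_projection) simp
  then have "continuous_map (Euclidean_space k) euclideanreal (\<lambda>x. \<Sum>i<k. (x i)\<^sup>2)"
    by (intro continuous_map_sum continuous_map_real_pow) auto
  then show "openin (Euclidean_space k) (topspace (open_disk k))"
    unfolding top by (rule openin_continuous_map_preimage) (simp flip: open_openin)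
  show "open_disk k = subtopology (Euclidean_space k) (topspace (open_disk k))"
    unfolding open_disk_def closed_disk_def subtopology_subtopology
    by (rule arg_cong[where f = "subtopology (Euclidean_space k)"]) auto
  show "(\<lambda>i. 0) \<in> topspace (open_disk k)"
    by (simp add: top topspace_Euclidean_space)
qed

text \<open>If \<open>k < j\<close>, a homeomorphism would map the open \<open>j\<close>-disk to a subset of a hyperplane of
  \<open>j\<close>-space, which by invariance of domain would be open.\<close>

lemma open_disk_dimension_le:
  assumes "open_disk j homeomorphic_space open_disk k"
  shows "j \<le> k"
proof (rule ccontr)
  assume "\<not> j \<le> k"
  then have kj: "k < j" by simp
  let ?U = "topspace (open_disk j)"
  obtain f where f: "homeomorphic_map (open_disk j) (open_disk k) f"
    using assms homeomorphic_space by blast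
  have Ek: "Euclidean_space k = subtopology (Euclidean_space j) (topspace (Euclidean_space k))"
    using kj by (metis Euclidean_space_def less_imp_le inf.absorb_iff2 subset_Euclidean_space subtopology_subtopology topspace_Euclidean_space)
  have cont: "continuous_map (subtopology (Euclidean_space j) ?U) (Euclidean_space k) f"
    using f open_disk_eq by (metis homeomorphic_imp_continuous_map continuous_map_into_fulltopology)
  have "f ` ?U \<subseteq> topspace (Euclidean_space k)"
    using f openin_subset[OF openin_open_disk] by (auto simp: homeomorphic_eq_everything_map)
  then have zero: "f x k = 0" if "x \<in> ?U" for x
    using that by (auto simp: topspace_Euclidean_space)
  have ope: "openin (Euclidean_space j) (f ` ?U)"
  proof (rule invariance_of_domain_Euclidean_space[OF openin_open_disk])
    show "continuous_map (subtopology (Euclidean_space j) ?U) (Euclidean_space j) f"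
      using cont Ek by (metis continuous_map_into_fulltopology)
    show "inj_on f ?U"
      using f by (simp add: homeomorphic_eq_everything_map)
  qed
  define W where "W = f ` ?U"
  obtain p where p: "p \<in> W"
    using zero_in_open_disk by (auto simp: W_def)
  have Wk: "q k = 0" if "q \<in> W" for q
    using that zero by (auto simp: W_def)
  have opeW: "openin (Euclidean_space j) W"
    using ope by (simp add: W_def)
  have "p \<in> topspace (Euclidean_space j)"
    using p opeW openin_subset by blast
  \<comment> \<open>The line through \<open>p\<close> in the direction of coordinate \<open>k\<close> meets \<open>W\<close> in one point only, but
    its intersection with an open set is open in the line.\<close>
  then have "continuous_map euclideanreal (Euclidean_space j) (\<lambda>t. p(k := t))"
    using kj by (auto simp: Euclidean_space_def continuous_map_in_subtopology continuous_map_componentwise_UNIV)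
  then have "openin euclideanreal {t \<in> topspace euclideanreal. p(k := t) \<in> W}"
    using opeW by (rule openin_continuous_map_preimage)
  moreover have "{t \<in> topspace euclideanreal. p(k := t) \<in> W} = {0}"
  proof (intro equalityI subsetI)
    fix t assume "t \<in> {t \<in> topspace euclideanreal. p(k := t) \<in> W}"
    then have "p(k := t) \<in> W"
      by simp
    from Wk[OF this] show "t \<in> {0}"
      by simp
  next
    fix t :: real assume "t \<in> {0}"
    with p Wk[OF p] show "t \<in> {t \<in> topspace euclideanreal. p(k := t) \<in> W}"
      by (simp add: fun_upd_idem)
  qed
  ultimately have "open {0::real}"
    by (simp only: open_openin)
  then show False
    by (simp add: not_open_singleton)
qed

lemma homeomorphic_map_face_interior:
  assumes h: "homeomorphic_map (closed_disk k) (top_of_set F) h"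
    and bd: "h ` disk_boundary k = rel_frontier F" and "closed F"
  shows "homeomorphic_map (open_disk k) (top_of_set (rel_interior F)) h"
proof -
  have inj: "inj_on h (topspace (closed_disk k))" and surj: "h ` topspace (closed_disk k) = F"
    using h by (auto simp: homeomorphic_eq_everything_map)
  have "disk_boundary k \<subseteq> topspace (closed_disk k)"
    by (auto simp: disk_boundary_def closed_disk_def)
  then have "h ` (topspace (closed_disk k) - disk_boundary k) = rel_interior F"
    using inj_on_image_set_diff[OF inj, of "topspace (closed_disk k)" "disk_boundary k"]
      rel_interior_subset[of F]
    by (auto simp: surj bd rel_frontier_def \<open>closed F\<close>)
  then have "homeomorphic_map (open_disk k) (subtopology (top_of_set F) (rel_interior F)) h"
    unfolding open_disk_def using rel_interior_subset[of F]
    by (intro homeomorphic_map_subtopologies[OF h]) (auto simp: Int_absorb1 Int_absorb2)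
  then show ?thesis
    using rel_interior_subset[of F] by (simp add: subtopology_subtopology Int_absorb1)
qed

text \<open>Being a cell is defined by the existence of a homeomorphism, so a set could a priori be a cell of
  several dimensions; the skeleta can be computed because this does not happen.\<close>

lemma is_cell_face_interior:
  fixes P :: "'a::euclidean_space set"
  assumes P: "polytope P" and F: "F face_of P" "F \<noteq> {}"
  shows "is_cell (top_of_set P) j (rel_interior F) \<longleftrightarrow> aff_dim F = int j"
proof -
  have poly: "polytope F"
    using face_of_polytope_polytope[OF P F(1)] .
  obtain k where k: "aff_dim F = int k"
    using F(2) by (metis aff_dim_negative_iff not_less zero_le_imp_eq_int)
  obtain h where h: "homeomorphic_map (closed_disk k) (top_of_set F) h"
    "h ` disk_boundary k = rel_frontier F"
    using ex_disk_homeomorphism[OF polytope_imp_convex[OF poly] polytope_imp_compact[OF poly] k] .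
  have sub: "rel_interior F \<subseteq> P"
    using rel_interior_subset face_of_imp_subset[OF F(1)] by blast
  have top: "subtopology (top_of_set P) (rel_interior F) = top_of_set (rel_interior F)"
    using sub by (simp add: subtopology_subtopology Int_absorb1)
  have cell: "top_of_set (rel_interior F) homeomorphic_space open_disk k"
    using homeomorphic_map_face_interior[OF h polytope_imp_closed[OF poly]]
    by (metis homeomorphic_map_imp_homeomorphic_space homeomorphic_space_sym)
  have "j = k" if "top_of_set (rel_interior F) homeomorphic_space open_disk j"
    using cell that
    by (meson antisym open_disk_dimension_le homeomorphic_space_sym homeomorphic_space_trans)
  then have "is_cell (top_of_set P) j (rel_interior F) \<longleftrightarrow> j = k"
    unfolding is_cell_def top using cell sub by auto
  then show ?thesis
    using k by auto
qed

section \<open>The face decomposition of a polytope\<close>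

definition face_interiors :: "'a::euclidean_space set \<Rightarrow> 'a set set" where
  "face_interiors P = {rel_interior F |F. F face_of P \<and> F \<noteq> {}}"

text \<open>A point outside the relative interior lies on a proper face, which is a polytope of smaller
  dimension.\<close>

lemma ex_face_interior:
  fixes P :: "'a::euclidean_space set"
  assumes "polytope P" "x \<in> P"
  shows "\<exists>F. F face_of P \<and> x \<in> rel_interior F"
  using assms
proof (induction "nat (aff_dim P + 1)" arbitrary: P rule: less_induct)
  case less
  show ?case
  proof (cases "x \<in> rel_interior P")
    case True
    then show ?thesis
      using face_of_refl polytope_imp_convex less.prems by blast
  next
    case False
    then have "x \<in> rel_frontier P"
      using less.prems by (simp add: rel_frontier_def polytope_imp_closed)
    then obtain G where G: "G face_of P" "G \<noteq> P" "x \<in> G"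
      using rel_frontier_of_polyhedron_alt polytope_imp_polyhedron less.prems by blast
    have "aff_dim G < aff_dim P"
      using G face_of_aff_dim_lt polytope_imp_convex less.prems by blast
    then have "nat (aff_dim G + 1) < nat (aff_dim P + 1)"
      using aff_dim_geq[of G] by linarith
    then obtain F where "F face_of G" "x \<in> rel_interior F"
      using less.hyps G less.prems face_of_polytope_polytope by blast
    then show ?thesis
      using G face_of_trans by blast
  qed
qed

lemma rel_frontier_subset_skeleton:
  fixes P :: "'a::euclidean_space set"
  assumes P: "polytope P" and F: "F face_of P" "aff_dim F = int k"
  shows "rel_frontier F \<subseteq> skeleton (top_of_set P) (face_interiors P) (int k - 1)"
proof
  fix x assume "x \<in> rel_frontier F"
  have poly: "polytope F"
    using face_of_polytope_polytope[OF P F(1)] .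
  then have x: "x \<in> F" "x \<notin> rel_interior F"
    using \<open>x \<in> rel_frontier F\<close> by (auto simp: rel_frontier_def polytope_imp_closed)
  obtain G where G: "G face_of F" "x \<in> rel_interior G"
    using ex_face_interior[OF poly x(1)] by blast
  then have "G \<noteq> F"
    using x by blast
  then have lt: "aff_dim G < int k"
    using face_of_aff_dim_lt[OF polytope_imp_convex[OF poly] G(1)] F(2) by simp
  have G': "G face_of P" "G \<noteq> {}"
    using G F face_of_trans by auto
  then obtain j where j: "aff_dim G = int j"
    by (metis aff_dim_negative_iff not_less zero_le_imp_eq_int)
  have "is_cell (top_of_set P) j (rel_interior G) \<and> int j \<le> int k - 1"
    using is_cell_face_interior[OF P G'] j lt by simp
  moreover have "rel_interior G \<in> face_interiors P"
    using G' by (auto simp: face_interiors_def)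
  ultimately show "x \<in> skeleton (top_of_set P) (face_interiors P) (int k - 1)"
    using G(2) unfolding skeleton_def by blast
qed

lemma face_interior_disjoint_skeleton:
  fixes P :: "'a::euclidean_space set"
  assumes P: "polytope P" and F: "F face_of P" "aff_dim F = int k"
  shows "rel_interior F \<inter> skeleton (top_of_set P) (face_interiors P) (int k - 1) = {}"
proof (rule ccontr)
  assume "\<not> ?thesis"
  then obtain G j where G: "G face_of P" "G \<noteq> {}" "rel_interior F \<inter> rel_interior G \<noteq> {}"
    "is_cell (top_of_set P) j (rel_interior G)" "int j \<le> int k - 1"
    by (auto simp: skeleton_def face_interiors_def)
  then have "F = G"
    using face_of_eq F(1) by blast
  then show False
    using is_cell_face_interior[OF P G(1,2), of j] G(4,5) F(2) by auto
qed

text \<open>The homeomorphisms chosen for the single faces fit together into one family indexed by cells,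
  since faces with the same nonempty relative interior are equal.\<close>

lemma ex_natural_identifications:
  fixes P :: "'a::euclidean_space set"
  assumes P: "polytope P"
  shows "\<exists>\<Phi>. natural_identifications P E \<Phi>"
proof -
  have "\<exists>h. \<forall>k F. is_k_face P k F \<and> e = rel_interior F \<longrightarrow>
      homeomorphic_map (closed_disk k) (top_of_set F) h \<and> h ` disk_boundary k = rel_frontier F" for e
  proof (cases "\<exists>k F. is_k_face P k F \<and> e = rel_interior F")
    case True
    then obtain k F where F: "is_k_face P k F" "e = rel_interior F"
      by blast
    then have poly: "polytope F"
      using face_of_polytope_polytope[OF P] by (auto simp: is_k_face_def)
    have "F \<noteq> {}"
      using F by (auto simp: is_k_face_def)
    then have "e \<noteq> {}"
      using F poly polytope_imp_convex rel_interior_eq_empty by blast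
    have "F' = F \<and> k' = k" if "is_k_face P k' F'" "e = rel_interior F'" for k' F'
      using that F \<open>e \<noteq> {}\<close> face_of_eq[of F' P F] by (auto simp: is_k_face_def)
    moreover obtain h where "homeomorphic_map (closed_disk k) (top_of_set F) h"
      "h ` disk_boundary k = rel_frontier F"
      using ex_disk_homeomorphism[OF polytope_imp_convex[OF poly] polytope_imp_compact[OF poly]]
        F(1) by (auto simp: is_k_face_def)
    ultimately show ?thesis
      by metis
  qed auto
  then show ?thesis
    unfolding natural_identifications_def by metis
qed

text \<open>A natural identification of a face \<open>F\<close> has image \<open>F\<close>, which is the disjoint union of the cell and
  of a part of the lower skeleton; all conditions on characteristic maps are restrictions of this
  one homeomorphism.\<close>

theorem polytope_regular_CW_complex:
  fixes P :: "'a::euclidean_space set"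
  assumes P: "polytope P" and nat: "natural_identifications P (face_interiors P) \<Phi>"
  shows "regular_CW_complex (top_of_set P) (face_interiors P) \<Phi>"
proof -
  let ?X = "top_of_set P" and ?E = "face_interiors P"
  have attach: "embedding_map (closed_disk k) ?X (\<Phi> e) \<and>
      relative_homeomorphism (closed_disk k) (disk_boundary k)
        (subtopology ?X (e \<union> skeleton ?X ?E (int k - 1))) (skeleton ?X ?E (int k - 1)) (\<Phi> e) \<and>
      homeomorphic_map (open_disk k) (subtopology ?X e) (\<Phi> e)"
    if e: "e \<in> ?E" and cell: "is_cell ?X k e" for e k
  proof -
    let ?K = "skeleton ?X ?E (int k - 1)"
    obtain F where F: "F face_of P" "F \<noteq> {}" "e = rel_interior F"
      using e by (auto simp: face_interiors_def)
    have dim: "aff_dim F = int k"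
      using is_cell_face_interior[OF P F(1,2)] cell F(3) by simp
    have FP: "F \<subseteq> P"
      using F(1) face_of_imp_subset by blast
    have closed: "closed F"
      using face_of_polytope_polytope[OF P F(1)] polytope_imp_closed by blast
    have h: "homeomorphic_map (closed_disk k) (top_of_set F) (\<Phi> e)"
      and bd: "\<Phi> e ` disk_boundary k = rel_frontier F"
      using nat e F dim by (auto simp: natural_identifications_def is_k_face_def)
    have eP: "e \<subseteq> P"
      using F(3) FP rel_interior_subset by blast
    have KP: "?K \<subseteq> P"
      by (auto simp: skeleton_def is_cell_def)
    have disj: "e \<inter> ?K = {}"
      using face_interior_disjoint_skeleton[OF P F(1) dim] F(3) by simp
    have sub: "rel_frontier F \<subseteq> ?K"
      using rel_frontier_subset_skeleton[OF P F(1) dim] .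
    have FeK: "F \<subseteq> e \<union> ?K"
      using sub F(3) closed by (auto simp: rel_frontier_def)
    have surj: "\<Phi> e ` topspace (closed_disk k) = F"
      using h by (auto simp: homeomorphic_eq_everything_map)
    have open_map: "homeomorphic_map (open_disk k) (top_of_set e) (\<Phi> e)"
      using homeomorphic_map_face_interior[OF h bd closed] F(3) by simp
    have emb: "embedding_map (closed_disk k) ?X (\<Phi> e)"
      using h surj FP by (simp add: embedding_map_def subtopology_subtopology Int_absorb1)
    have top: "subtopology ?X (e \<union> ?K) = top_of_set (e \<union> ?K)"
      using eP KP by (simp add: subtopology_subtopology Int_absorb1)
    have "relative_homeomorphism (closed_disk k) (disk_boundary k)
        (top_of_set (e \<union> ?K)) ?K (\<Phi> e)"
      unfolding relative_homeomorphism_def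
    proof (intro conjI)
      show "disk_boundary k \<subseteq> topspace (closed_disk k)"
        by (auto simp: disk_boundary_def closed_disk_def)
      show "?K \<subseteq> topspace (top_of_set (e \<union> ?K))"
        by simp
      show "continuous_map (closed_disk k) (top_of_set (e \<union> ?K)) (\<Phi> e)"
        using homeomorphic_imp_continuous_map[OF h] FeK surj
        by (auto simp: continuous_map_in_subtopology)
      show "\<Phi> e ` disk_boundary k \<subseteq> ?K"
        using bd sub by simp
      have "subtopology (top_of_set (e \<union> ?K)) (topspace (top_of_set (e \<union> ?K)) - ?K) = top_of_set e"
        using disj by (simp add: subtopology_subtopology Un_Diff Diff_triv Int_absorb1)
      then show "homeomorphic_map (subtopology (closed_disk k) (topspace (closed_disk k) - disk_boundary k))
          (subtopology (top_of_set (e \<union> ?K)) (topspace (top_of_set (e \<union> ?K)) - ?K)) (\<Phi> e)"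
        using open_map by (simp add: open_disk_def)
    qed
    moreover have "subtopology ?X e = top_of_set e"
      using eP by (simp add: subtopology_subtopology Int_absorb1)
    ultimately show ?thesis
      using emb open_map top by metis
  qed
  have "Hausdorff_space ?X"
    by (simp add: Hausdorff_space_subtopology)
  moreover have "finite ?E"
    using finite_polytope_faces[OF P] finite_subset
    by (auto simp: face_interiors_def intro: finite_subset[of _ "rel_interior ` {F. F face_of P}"])
  moreover have "\<exists>k. is_cell ?X k e" if "e \<in> ?E" for e
    using that is_cell_face_interior[OF P] aff_dim_negative_iff zero_le_imp_eq_int
    unfolding face_interiors_def by (smt (verit) mem_Collect_eq)
  moreover have "\<Union>?E = topspace ?X"
  proof
    show "\<Union>?E \<subseteq> topspace ?X"
      using face_of_imp_subset rel_interior_subset by (fastforce simp: face_interiors_def)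
    show "topspace ?X \<subseteq> \<Union>?E"
      using ex_face_interior[OF P] by (fastforce simp: face_interiors_def)
  qed
  moreover have "pairwise disjnt ?E"
    unfolding pairwise_def face_interiors_def disjnt_def using face_of_eq by blast
  ultimately show ?thesis
    using attach unfolding regular_CW_complex_def CW_complex_def by blast
qed

section \<open>The half cube\<close>

lemma polytope_half_cube: "polytope (half_cube :: (real ^ 'n) set)"
proof -
  have "half_cube_points \<subseteq> (vec_lambda ` (UNIV \<rightarrow>\<^sub>E {1, - 1}) :: (real ^ 'n) set)"
  proof
    fix x :: "real ^ 'n" assume "x \<in> half_cube_points"
    then have "vec_nth x \<in> UNIV \<rightarrow>\<^sub>E {1, - 1}"
      by (auto simp: half_cube_points_def PiE_UNIV_domain)
    then show "x \<in> vec_lambda ` (UNIV \<rightarrow>\<^sub>E {1, - 1})"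
      by (metis imageI vec_lambda_eta)
  qed
  moreover have "finite (vec_lambda ` (UNIV \<rightarrow>\<^sub>E {1, - 1}) :: (real ^ 'n) set)"
    by (intro finite_imageI finite_PiE) auto
  ultimately show ?thesis
    unfolding half_cube_def polytope_def using finite_subset by blast
qed

lemma half_cube_nonempty: "(half_cube :: (real ^ 'n) set) \<noteq> {}"
proof -
  have "(1 :: real ^ 'n) \<in> half_cube_points"
    by (simp add: half_cube_points_def)
  then show ?thesis
    by (auto simp: half_cube_def)
qed

text \<open>The vertices are the faces of dimension \<open>0\<close>, each equal to its own relative interior. A proper face
  has a smaller dimension than the half cube, hence one below \<open>n\<close>, so that the faces of the second
  family together with the vertices and the half cube itself are all the nonempty faces.\<close>

lemma half_cube_cells_eq: "half_cube_cells = face_interiors (half_cube :: (real ^ 'n) set)"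
proof
  have conv: "convex (half_cube :: (real ^ 'n) set)"
    by (simp add: polytope_imp_convex polytope_half_cube)
  show "half_cube_cells \<subseteq> face_interiors (half_cube :: (real ^ 'n) set)"
  proof
    fix e :: "(real ^ 'n) set"
    assume "e \<in> half_cube_cells"
    then consider v where "e = {v}" "v extreme_point_of half_cube"
      | F k where "e = rel_interior F" "0 < k" "is_k_face half_cube k F"
      | "e = rel_interior half_cube"
      by (auto simp: half_cube_cells_def)
    then show "e \<in> face_interiors half_cube"
    proof cases
      case 1
      then show ?thesis
        unfolding face_interiors_def by (intro CollectI exI[of _ "{v}"]) (simp add: face_of_singleton)
    next
      case 2
      then show ?thesis
        unfolding face_interiors_def is_k_face_def by force
    next
      case 3
      then show ?thesis
        using face_of_refl[OF conv] half_cube_nonempty unfolding face_interiors_def by blast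
    qed
  qed
  show "face_interiors half_cube \<subseteq> (half_cube_cells :: (real ^ 'n) set set)"
  proof
    fix e :: "(real ^ 'n) set"
    assume "e \<in> face_interiors half_cube"
    then obtain F where F: "F face_of half_cube" "F \<noteq> {}" "e = rel_interior F"
      by (auto simp: face_interiors_def)
    then obtain k where k: "aff_dim F = int k"
      by (metis aff_dim_negative_iff not_less zero_le_imp_eq_int)
    consider "F = half_cube" | "F \<noteq> half_cube" "k = 0" | "F \<noteq> half_cube" "0 < k"
      by blast
    then show "e \<in> half_cube_cells"
    proof cases
      case 1
      then show ?thesis
        using F(3) by (simp add: half_cube_cells_def)
    next
      case 2
      then obtain v where "F = {v}"
        using k by (auto simp: aff_dim_eq_0)
      then show ?thesis
        using F by (auto simp: half_cube_cells_def face_of_singleton)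
    next
      case 3
      have "aff_dim F < aff_dim (half_cube :: (real ^ 'n) set)"
        using face_of_aff_dim_lt[OF conv F(1) 3(1)] .
      also have "\<dots> \<le> int CARD('n)"
        using aff_dim_le_DIM[of "half_cube :: (real ^ 'n) set"] by simp
      finally show ?thesis
        using F k 3 unfolding half_cube_cells_def is_k_face_def by auto
    qed
  qed
qed

theorem theorem3p1p2:
  assumes "CARD('n::finite) \<ge> 4"
  shows "(\<exists>\<Phi>. natural_identifications (half_cube :: (real ^ 'n) set) half_cube_cells \<Phi>) \<and>
    (\<forall>\<Phi>. natural_identifications (half_cube :: (real ^ 'n) set) half_cube_cells \<Phi> \<longrightarrow>
       regular_CW_complex (top_of_set (half_cube :: (real ^ 'n) set)) half_cube_cells \<Phi>)"
  using ex_natural_identifications[OF polytope_half_cube]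
    polytope_regular_CW_complex[OF polytope_half_cube]
  unfolding half_cube_cells_eq by blast

end
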